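(* Let $p$ be a prime and let $a$ be a positive integer. Let $h$ be a $p$-adic integer and set $w_k(h)=\binom{h}{k}\binom{h+k}{k}$ for $k\in\{0,1,2,\ldots\}$. Then $$\left(\sum_{k=0}^{p^a-1}w_k(h)x^k\right)\left(\sum_{k=0}^{p^a-1}w_k(h)y^k\right)\equiv\sum_{k=0}^{p^a-1}w_k(h)\,S_k(x,y)\pmod{p^2},$$ where $$S_k(x,y)=\sum_{j=0}^k\binom{k+j}{2j}\binom{2j}{j}(xy+y)^j(x-y)^{k-j}.$$ In particular, if $p\ne2$ then $$\left(\sum_{k=0}^{p^a-1}\frac{\binom{2k}{k}^2}{(-16)^k}x^k\right)\left(\sum_{k=0}^{p^a-1}\frac{\binom{2k}{k}^2}{(-16)^k}y^k\right)\equiv\sum_{k=0}^{p^a-1}\frac{\binom{2k}{k}^2}{(-16)^k}S_k(x,y)\pmod{p^2}$$ and $$\left(\sum_{k=0}^{p^a-1}\frac{\binom{4k}{2k}\binom{2k}{k}}{(-64)^k}x^k\right)\left(\sum_{k=0}^{p^a-1}\frac{\binom{4k}{2k}\binom{2k}{k}}{(-64)^k}y^k\right)\equiv\sum_{k=0}^{p^a-1}\frac{\binom{4k}{2k}\binom{2k}{k}}{(-64)^k}S_k(x,y)\pmod{p^2};$$ and if $p>3$ then $$\left(\sum_{k=0}^{p^a-1}\frac{\binom{2k}{k}\binom{3k}{k}}{(-27)^k}x^k\right)\left(\sum_{k=0}^{p^a-1}\frac{\binom{2k}{k}\binom{3k}{k}}{(-27)^k}y^k\right)\equiv\sum_{k=0}^{p^a-1}\frac{\binom{2k}{k}\binom{3k}{k}}{(-27)^k}S_k(x,y)\pmod{p^2}$$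 and $$\left(\sum_{k=0}^{p^a-1}\frac{\binom{6k}{3k}\binom{3k}{k}}{(-432)^k}x^k\right)\left(\sum_{k=0}^{p^a-1}\frac{\binom{6k}{3k}\binom{3k}{k}}{(-432)^k}y^k\right)\equiv\sum_{k=0}^{p^a-1}\frac{\binom{6k}{3k}\binom{3k}{k}}{(-432)^k}S_k(x,y)\pmod{p^2}.$$
   Context: For a $p$-adic integer $z$ and an integer $k\ge0$, $\binom{z}{k}=z(z-1)\cdots(z-k+1)/k!$, which is again a $p$-adic integer. Here $x,y$ are indeterminates, and the congruences are between polynomials in $x,y$ with coefficients in $\mathbb{Z}_p$ (the ring of $p$-adic integers): congruence modulo $p^2$ means that all coefficients of the difference lie in $p^2\mathbb{Z}_p$. *)

theory Defs
  imports
    "HOL-Computational_Algebra.Computational_Algebra"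
    "Berlekamp_Zassenhaus.Finite_Field"
begin

text \<open>
  The prime \<open>p\<close> is carried by a type variable \<open>'p\<close> of class \<^class>\<open>prime_card\<close>, as \<open>p = CARD('p)\<close>.
  The ring of \<open>p\<close>-adic integers is the inverse limit of the rings of integers modulo \<open>p ^ n\<close>:
  a \<open>p\<close>-adic integer is a compatible sequence of least nonnegative residues.
\<close>

typedef (overloaded) 'p padic_int =
  "{f :: nat \<Rightarrow> int. \<forall>n. f n \<in> {0..<int CARD('p::prime_card) ^ n} \<and>
     f (Suc n) mod int CARD('p) ^ n = f n}"
  morphisms padic_residue Abs_padic_int
  by (rule exI[of _ "\<lambda>_. 0"]) (simp add: prime_gt_0_nat prime_card)

setup_lifting type_definition_padic_int

lemma prime_card_gt_0 [simp]: "int CARD('p::prime_card) > 0"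
  using prime_gt_0_int prime_card_int by blast

lemma mod_power_Suc: "(x::int) mod q ^ Suc n mod q ^ n = x mod q ^ n"
  by (simp add: mod_mod_cancel)

lemma padic_residue_mod: "padic_residue (x :: 'p::prime_card padic_int) n mod int CARD('p) ^ n = padic_residue x n"
  by (transfer, metis atLeastLessThan_iff mod_pos_pos_trivial)

lemma padic_residue_Suc: "padic_residue (x :: 'p::prime_card padic_int) (Suc n) mod int CARD('p) ^ n = padic_residue x n"
  by transfer blast

lemma padic_residue_add: "padic_residue (x :: 'p::prime_card padic_int) (n + k) mod int CARD('p) ^ n = padic_residue x n"
proof (induction k)
  case (Suc k)
  have "padic_residue x (n + Suc k) mod int CARD('p) ^ n
      = padic_residue x (Suc (n + k)) mod int CARD('p) ^ (n + k) mod int CARD('p) ^ n"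
    by (simp add: mod_mod_cancel le_imp_power_dvd)
  with Suc show ?case by (simp only: padic_residue_Suc)
qed (simp add: padic_residue_mod)

lemma padic_int_closed:
  assumes "\<And>n. g (Suc n) mod int CARD('p) ^ n = g n mod int CARD('p) ^ n"
  shows "g n mod int CARD('p::prime_card) ^ n \<in> {0..<int CARD('p) ^ n} \<and>
    g (Suc n) mod int CARD('p) ^ Suc n mod int CARD('p) ^ n = g n mod int CARD('p) ^ n"
  using assms mod_power_Suc[of "g (Suc n)" "int CARD('p)" n] by simp

instantiation padic_int :: (prime_card) comm_ring_1
begin

lift_definition zero_padic_int :: "'a padic_int" is "\<lambda>n. 0 mod int CARD('a) ^ n"
  by (intro padic_int_closed) simp

lift_definition one_padic_int :: "'a padic_int" is "\<lambda>n. 1 mod int CARD('a) ^ n"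
  by (intro padic_int_closed) simp

lift_definition plus_padic_int :: "'a padic_int \<Rightarrow> 'a padic_int \<Rightarrow> 'a padic_int"
  is "\<lambda>f g n. (f n + g n) mod int CARD('a) ^ n"
  by (rule padic_int_closed, rule mod_add_cong) (metis mod_mod_trivial)+

lift_definition times_padic_int :: "'a padic_int \<Rightarrow> 'a padic_int \<Rightarrow> 'a padic_int"
  is "\<lambda>f g n. (f n * g n) mod int CARD('a) ^ n"
  by (rule padic_int_closed, rule mod_mult_cong) (metis mod_mod_trivial)+

lift_definition uminus_padic_int :: "'a padic_int \<Rightarrow> 'a padic_int"
  is "\<lambda>f n. (- f n) mod int CARD('a) ^ n"
  by (rule padic_int_closed, rule mod_minus_cong) (metis mod_mod_trivial)+

lift_definition minus_padic_int :: "'a padic_int \<Rightarrow> 'a padic_int \<Rightarrow> 'a padic_int"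
  is "\<lambda>f g n. (f n - g n) mod int CARD('a) ^ n"
  by (rule padic_int_closed, rule mod_diff_cong) (metis mod_mod_trivial)+

instance
proof
  fix a b c :: "'a padic_int"
  show "a * b * c = a * (b * c)"
    by transfer (simp add: fun_eq_iff mod_simps mult.assoc)
  show "a * b = b * a"
    by transfer (simp add: fun_eq_iff mult.commute)
  show "1 * a = a"
    by (transfer, simp add: fun_eq_iff mod_simps)
  show "a + b + c = a + (b + c)"
    by transfer (simp add: fun_eq_iff mod_simps add.assoc)
  show "a + b = b + a"
    by transfer (simp add: fun_eq_iff add.commute)
  show "0 + a = a"
    by (transfer, simp add: fun_eq_iff mod_simps)
  show "- a + a = 0"
    by transfer (simp add: fun_eq_iff mod_simps)
  show "a - b = a + - b"
    by transfer (simp add: fun_eq_iff mod_simps)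
  show "(a + b) * c = a * c + b * c"
    by transfer (simp add: fun_eq_iff mod_simps distrib_right)
  have "1 < CARD('a)"
    by (rule prime_gt_1_nat[OF prime_card])
  then show "(0 :: 'a padic_int) \<noteq> 1"
    by transfer (auto simp: fun_eq_iff intro!: exI[of _ 1])
qed

end

lemma padic_residue_0 [simp]: "padic_residue 0 n = 0"
  by transfer simp

lemma padic_residue_times:
  "padic_residue (x * y :: 'p::prime_card padic_int) n
    = (padic_residue x n * padic_residue y n) mod int CARD('p) ^ n"
  by transfer simp

lemma padic_residue_plus:
  "padic_residue (x + y :: 'p::prime_card padic_int) n
    = (padic_residue x n + padic_residue y n) mod int CARD('p) ^ n"
  by transfer simp

lemma padic_residue_1: "padic_residue (1 :: 'p::prime_card padic_int) n = 1 mod int CARD('p) ^ n"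
  by transfer simp

lemma padic_residue_of_nat:
  "padic_residue (of_nat k :: 'p::prime_card padic_int) n = int k mod int CARD('p) ^ n"
proof (induction k)
  case 0
  show ?case by simp
next
  case (Suc k)
  have "padic_residue (of_nat (Suc k) :: 'p padic_int) n
      = (1 mod int CARD('p) ^ n + int k mod int CARD('p) ^ n) mod int CARD('p) ^ n"
    by (simp only: of_nat_Suc padic_residue_plus padic_residue_1 Suc)
  also have "\<dots> = int (Suc k) mod int CARD('p) ^ n"
    by (simp only: mod_add_eq of_nat_Suc)
  finally show ?case .
qed

lemma not_prime_power_dvd_mult:
  fixes u v q :: int
  assumes q: "prime q" and u: "\<not> q ^ m dvd u" and v: "\<not> q ^ n dvd v"
  shows "\<not> q ^ (m + n) dvd u * v"
proof -
  have nz: "u \<noteq> 0" "v \<noteq> 0" using u v by auto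
  have nu: "\<not> is_unit q" using q not_prime_unit by blast
  have "multiplicity q u < m" "multiplicity q v < n"
    using u v nz nu by (metis not_le multiplicity_dvd')+
  moreover have "multiplicity q (u * v) = multiplicity q u + multiplicity q v"
    using q nz by (intro prime_elem_multiplicity_mult_distrib prime_imp_prime_elem)
  ultimately show ?thesis
    using nz nu power_dvd_iff_le_multiplicity[of "u * v" q "m + n"] by auto
qed

instance padic_int :: (prime_card) idom
proof
  fix x y :: "'a padic_int"
  assume "x \<noteq> 0" "y \<noteq> 0"
  then obtain m n where m: "padic_residue x m \<noteq> 0" and n: "padic_residue y n \<noteq> 0"
    by (metis padic_residue_inject padic_residue_0 ext)
  let ?p = "int CARD('a)"
  have "\<not> ?p ^ m dvd padic_residue x (m + n)" "\<not> ?p ^ n dvd padic_residue y (n + m)"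
    using m n by (simp_all only: dvd_eq_mod_eq_0 padic_residue_add not_False_eq_True)
  then have "\<not> ?p ^ (m + n) dvd padic_residue x (m + n) * padic_residue y (m + n)"
    by (intro not_prime_power_dvd_mult prime_card_int) (simp_all add: add.commute)
  then show "x * y \<noteq> 0"
    by (metis dvd_eq_mod_eq_0 padic_residue_0 padic_residue_times)
qed

instance padic_int :: (prime_card) ring_char_0
proof
  show "inj (of_nat :: nat \<Rightarrow> 'a padic_int)"
  proof (rule injI)
    fix j k :: nat
    assume eq: "(of_nat j :: 'a padic_int) = of_nat k"
    have gt: "1 < CARD('a)"
      by (rule prime_gt_1_nat[OF prime_card])
    define n where "n = j + k"
    have "n < CARD('a) ^ n"
      by (rule power_gt_expt) (use gt in simp)
    then have "int n < int CARD('a) ^ n"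
      by (metis of_nat_less_iff of_nat_power)
    then have "int j < int CARD('a) ^ n" "int k < int CARD('a) ^ n"
      unfolding n_def by linarith+
    then have "int j mod int CARD('a) ^ n = int j" "int k mod int CARD('a) ^ n = int k"
      by (simp_all only: mod_pos_pos_trivial of_nat_0_le_iff)
    with eq show "j = k"
      by (metis padic_residue_of_nat of_nat_eq_iff)
  qed
qed

instance fract :: ("{idom, ring_char_0}") ring_char_0
proof
  show "inj (of_nat :: nat \<Rightarrow> 'a fract)"
    by (rule injI) (simp add: of_nat_fract eq_fract)
qed

instance fract :: ("{idom, ring_char_0}") field_char_0 ..

type_synonym 'p padic = "'p padic_int fract"

definition padic_ints :: "'p::prime_card padic set"  (\<open>\<int>\<^sub>p\<close>)
  where "\<int>\<^sub>p = range to_fract"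

text \<open>
  Polynomials in the indeterminates \<open>x\<close> and \<open>y\<close> over \<open>R\<close> are elements of \<open>R[x][y]\<close>.
\<close>

abbreviation indet_x :: "'a::comm_ring_1 poly poly"
  where "indet_x \<equiv> [:[:0, 1:]:]"

abbreviation indet_y :: "'a::comm_ring_1 poly poly"
  where "indet_y \<equiv> [:0, 1:]"

abbreviation const2 :: "'a::comm_ring_1 \<Rightarrow> 'a poly poly"
  where "const2 c \<equiv> [:[:c:]:]"

definition integral_poly2 :: "'p::prime_card padic poly poly \<Rightarrow> bool"
  where "integral_poly2 F \<longleftrightarrow> (\<forall>i j. poly.coeff (poly.coeff F i) j \<in> \<int>\<^sub>p)"

text \<open>
  Congruence of polynomials with coefficients in \<open>\<int>\<^sub>p\<close>.  Coefficients are written in the field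
  of \<open>p\<close>-adic numbers because they involve quotients; their integrality is part of the relation.
\<close>

definition padic_poly_cong ::
    "'p::prime_card padic poly poly \<Rightarrow> 'p padic poly poly \<Rightarrow> nat \<Rightarrow> bool"
    (\<open>(1[_ \<equiv> _] '(mod\<^sub>p _'))\<close>)
  where "[F \<equiv> G] (mod\<^sub>p m) \<longleftrightarrow> integral_poly2 F \<and> integral_poly2 G \<and>
    (\<forall>i j. \<exists>z\<in>\<int>\<^sub>p. poly.coeff (poly.coeff (F - G) i) j = of_nat m * z)"

definition w_coeff :: "nat \<Rightarrow> 'p::prime_card padic_int \<Rightarrow> 'p padic"
  where "w_coeff k h = (to_fract h gchoose k) * ((to_fract h + of_nat k) gchoose k)"

definition S_poly :: "nat \<Rightarrow> 'a::comm_ring_1 \<Rightarrow> 'a \<Rightarrow> 'a"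
  where "S_poly k x y = (\<Sum>j=0..k. of_nat (((k + j) choose (2 * j)) * ((2 * j) choose j))
                       * (x * y + y) ^ j * (x - y) ^ (k - j))"

end

theory Submission
  imports Defs "HOL-Number_Theory.Cong"
begin

text \<open>
  Since \<open>(k + 1)\<^sup>2 w\<^bsub>k+1\<^esub>(h) = (h(h + 1) - k(k + 1)) w\<^sub>k(h)\<close>, the products linearize exactly:
  \<open>w\<^sub>i w\<^sub>j = \<Sum>\<^sub>k s(k,i,j) w\<^sub>k\<close> with \<open>s(k,i,j) = C(i+j,k) C(k,i) C(k,j)\<close>. Two applications of Vandermonde's
  identity show that \<open>s(k,i,j)\<close> is also the coefficient of \<open>x\<^sup>i y\<^sup>j\<close> in \<open>S\<^sub>k\<close>. Hence the two sides of the
  congruence differ, at \<open>x\<^sup>i y\<^sup>j\<close> with \<open>i, j < p\<^sup>a\<close>, only by the terms with \<open>k \<ge> p\<^sup>a\<close>; there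
  \<open>s(k,i,j) = C(i+j,i) C(j,k-i) C(k,j)\<close>, and both the first and the last factor are divisible by \<open>p\<close>,
  by Kummer's carry argument. The four special cases are \<open>h = -1/2, -1/4, -1/3, -1/6\<close>.
\<close>

section \<open>The connection coefficients\<close>

text \<open>For max(i, j) \<le> k \<le> i + j this is C(i+j, i) times the multinomial number k! /
  ((i+j-k)! (k-i)! (k-j)!). Elsewhere it is 0, which lets the sums below change their
  ranges.\<close>

definition conn_coeff :: "nat \<Rightarrow> nat \<Rightarrow> nat \<Rightarrow> nat"
  where "conn_coeff k i j = ((i + j) choose k) * (k choose i) * (k choose j)"

text \<open>Trinomial revision with lower index \<open>k - l\<close> in place of
  \<open>l - r\<close>. In this form it also covers l < r, where both sides vanish, so that sums
  over \<open>l\<close> can keep their full range.\<close>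

lemma choose_mult_complement:
  fixes k l r :: nat
  assumes "l \<le> k" "r \<le> k"
  shows "(k choose l) * (l choose r) = (k choose r) * ((k - r) choose (k - l))"
proof (cases "r \<le> l")
  case True
  then have "(k choose l) * (l choose r) = (k choose r) * ((k - r) choose (l - r))"
    using assms by (intro choose_mult) auto
  also have "(k - r) choose (l - r) = (k - r) choose (k - l)"
    using True assms by (subst binomial_symmetric) auto
  finally show ?thesis .
next
  case False
  then show ?thesis using assms by (simp add: binomial_eq_0)
qed

section \<open>Divisibility of the connection coefficients by p^2\<close>

text \<open>Absorption shows that p^a divides l C(p^a, l). If \<open>p\<close> did not divide the
  binomial, p^a would divide \<open>l\<close>, which is too small.\<close>

lemma prime_dvd_prime_power_choose:
  fixes p :: nat
  assumes p: "prime p" and l: "0 < l" "l < p ^ a"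
  shows "p dvd (p ^ a choose l)"
proof (rule ccontr)
  assume "\<not> p dvd (p ^ a choose l)"
  then have "coprime (p ^ a) (p ^ a choose l)"
    using p by (simp add: prime_imp_coprime)
  moreover have "l * (p ^ a choose l) = p ^ a * ((p ^ a - 1) choose (l - 1))"
    using times_binomial_minus1_eq[of l "p ^ a"] l by simp
  then have "p ^ a dvd l * (p ^ a choose l)"
    by simp
  ultimately have "p ^ a dvd l"
    by (simp add: coprime_dvd_mult_left_iff)
  then show False
    using l by (auto dest: dvd_imp_le)
qed

text \<open>Adding \<open>i\<close> and \<open>j\<close> in base \<open>p\<close> produces a carry into the digit of \<open>p ^ a\<close>.\<close>

lemma prime_dvd_choose_carry:
  fixes p :: nat
  assumes p: "prime p" and ij: "i < p ^ a" "j < p ^ a" "p ^ a \<le> i + j"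
  shows "p dvd ((i + j) choose i)"
proof -
  define m where "m = i + j - p ^ a"
  have m: "i + j = p ^ a + m" "m < i"
    using ij by (auto simp: m_def)
  \<comment> \<open>Vandermonde for p^a + m: the term l = 0 vanishes because m < i, and for 0 < l
    \<le> i < p^a the factor C(p^a, l) is divisible by \<open>p\<close>.\<close>
  have "p dvd (\<Sum>l\<le>i. (p ^ a choose l) * (m choose (i - l)))"
  proof (rule dvd_sum)
    fix l assume "l \<in> {..i}"
    then show "p dvd (p ^ a choose l) * (m choose (i - l))"
      using prime_dvd_prime_power_choose[OF p, of l a] m ij
      by (cases "l = 0") (auto simp: binomial_eq_0)
  qed
  then show ?thesis
    by (simp only: vandermonde m)
qed

lemma prime_square_dvd_conn_coeff:
  fixes p :: nat
  assumes p: "prime p" and ij: "i < p ^ a" "j < p ^ a" and k: "p ^ a \<le> k"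
  shows "p\<^sup>2 dvd conn_coeff k i j"
proof (cases "k \<le> i + j")
  case True
  have "(i + j choose k) * (k choose i) = (i + j choose i) * (j choose (k - i))"
    using True ij k choose_mult[of i k "i + j"] by simp
  then have "conn_coeff k i j = ((i + j) choose i) * (k choose j) * (j choose (k - i))"
    by (simp add: conn_coeff_def)
  moreover have "p dvd ((i + j) choose i)"
    using prime_dvd_choose_carry[OF p] True ij k by simp
  \<comment> \<open>The second carry: k - j \<le> i < p^a and j < p^a, while their sum
    \<open>k\<close> is at least p^a.\<close>
  moreover have "p dvd ((j + (k - j)) choose j)"
    using True ij k by (intro prime_dvd_choose_carry[OF p]) auto
  then have "p dvd (k choose j)"
    using True ij k by simp
  ultimately show ?thesis
    by (simp add: power2_eq_square mult_dvd_mono)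
qed (simp add: conn_coeff_def binomial_eq_0)

section \<open>Two sums of Vandermonde type\<close>

text \<open>Trinomial revision C(k, l) C(k-l, m-l) = C(k, m) C(m, l) pulls out C(k, m) and leaves a
  Vandermonde sum.\<close>

lemma sum_choose_squared_mult_choose:
  fixes k m :: nat
  assumes "m \<le> k"
  shows "(\<Sum>l\<le>m. (k choose l)\<^sup>2 * ((k - l) choose (m - l))) = (k choose m) * ((k + m) choose m)"
proof -
  have "(k choose l)\<^sup>2 * ((k - l) choose (m - l)) = (k choose m) * ((k choose l) * (m choose (m - l)))"
    if "l \<le> m" for l
    using that assms choose_mult[of l m k] binomial_symmetric[of l m]
    by (simp add: power2_eq_square algebra_simps)
  then have "(\<Sum>l\<le>m. (k choose l)\<^sup>2 * ((k - l) choose (m - l)))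
      = (\<Sum>l\<le>m. (k choose m) * ((k choose l) * (m choose (m - l))))"
    by (intro sum.cong) auto
  also have "\<dots> = (k choose m) * ((k + m) choose m)"
    by (simp only: vandermonde flip: sum_distrib_left)
  finally show ?thesis .
qed

text \<open>One factor C(k, l) is spent on C(l, r), the other, as C(k, k-l), on C(k-l, t). By
  \<open>choose_mult_complement\<close> this pulls out C(k, r) C(k, t) and leaves a Vandermonde sum
  for C(i+j, k) with i = k - r, j = k - t.\<close>

lemma sum_choose_squared_choose_choose:
  fixes k r t :: nat
  assumes "r \<le> k" "t \<le> k"
  shows "(\<Sum>l\<le>k. (k choose l)\<^sup>2 * (l choose r) * ((k - l) choose t)) = conn_coeff k (k - r) (k - t)"
proof -
  have "(k choose l)\<^sup>2 * (l choose r) * ((k - l) choose t)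
      = (k choose r) * (k choose t) * (((k - t) choose l) * ((k - r) choose (k - l)))"
    if "l \<le> k" for l
  proof -
    have "(k choose l) * ((k - l) choose t) = (k choose t) * ((k - t) choose l)"
      using choose_mult_complement[of "k - l" k t] that assms by (simp flip: binomial_symmetric)
    with choose_mult_complement[of l k r] that assms show ?thesis
      by (simp add: power2_eq_square algebra_simps)
  qed
  then have "(\<Sum>l\<le>k. (k choose l)\<^sup>2 * (l choose r) * ((k - l) choose t))
      = (\<Sum>l\<le>k. (k choose r) * (k choose t) * (((k - t) choose l) * ((k - r) choose (k - l))))"
    by (intro sum.cong) auto
  also have "\<dots> = (k choose r) * (k choose t) * ((k - t + (k - r)) choose k)"
    by (simp only: vandermonde flip: sum_distrib_left)
  also have "\<dots> = conn_coeff k (k - r) (k - t)"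
    using assms by (simp add: conn_coeff_def add.commute flip: binomial_symmetric)
  finally show ?thesis .
qed

section \<open>Expansion of \<open>S_poly\<close> in monomials\<close>

text \<open>Expand (A + B)^(k-l) and collect A^m B^(k-m); the coefficient is the sum in
  \<open>sum_choose_squared_mult_choose\<close>. The right side is preferable because for
  \<open>S_poly\<close> both A and A + B factor.\<close>

lemma sum_choose_choose_eq_sum_choose_squared:
  fixes A B :: "'a::comm_ring_1"
  shows "(\<Sum>m\<le>k. of_nat ((k choose m) * ((k + m) choose m)) * A ^ m * B ^ (k - m))
       = (\<Sum>l\<le>k. of_nat ((k choose l)\<^sup>2) * A ^ l * (A + B) ^ (k - l))"
proof -
  have "(\<Sum>l\<le>k. of_nat ((k choose l)\<^sup>2) * A ^ l * (A + B) ^ (k - l))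
      = (\<Sum>l\<le>k. \<Sum>m=l..k. of_nat ((k choose l)\<^sup>2 * ((k - l) choose (m - l))) * (A ^ m * B ^ (k - m)))"
  proof (rule sum.cong)
    fix l assume "l \<in> {..k}"
    then have l: "l \<le> k" by simp
    have "(A + B) ^ (k - l) = (\<Sum>m\<le>k - l. of_nat ((k - l) choose m) * A ^ m * B ^ (k - l - m))"
      by (rule binomial_ring)
    also have "\<dots> = (\<Sum>m=l..k. of_nat ((k - l) choose (m - l)) * A ^ (m - l) * B ^ (k - m))"
      using l by (intro sum.reindex_bij_witness[of _ "\<lambda>m. m - l" "\<lambda>m. m + l"]) (auto simp: add.commute)
    finally have E: "(A + B) ^ (k - l) = \<dots>" .
    show "of_nat ((k choose l)\<^sup>2) * A ^ l * (A + B) ^ (k - l)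
      = (\<Sum>m=l..k. of_nat ((k choose l)\<^sup>2 * ((k - l) choose (m - l))) * (A ^ m * B ^ (k - m)))"
      unfolding E sum_distrib_left
    proof (rule sum.cong)
      fix m assume "m \<in> {l..k}"
      then have "A ^ m = A ^ l * A ^ (m - l)"
        by (simp flip: power_add)
      then show "of_nat ((k choose l)\<^sup>2) * A ^ l * (of_nat ((k - l) choose (m - l)) * A ^ (m - l) * B ^ (k - m))
        = of_nat ((k choose l)\<^sup>2 * ((k - l) choose (m - l))) * (A ^ m * B ^ (k - m))"
        by (simp add: mult_ac)
    qed simp
  qed simp
  also have "\<dots> = (\<Sum>m\<le>k. \<Sum>l\<le>m. of_nat ((k choose l)\<^sup>2 * ((k - l) choose (m - l))) * (A ^ m * B ^ (k - m)))"
    unfolding sum.Sigma[OF finite_atMost ballI[OF finite_atMost]]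
      sum.Sigma[OF finite_atMost ballI[OF finite_atLeastAtMost]]
    by (rule sum.reindex_bij_witness[of _ "\<lambda>(a, b). (b, a)" "\<lambda>(a, b). (b, a)"]) auto
  also have "\<dots> = (\<Sum>m\<le>k. of_nat ((k choose m) * ((k + m) choose m)) * A ^ m * B ^ (k - m))"
  proof (rule sum.cong)
    fix m assume "m \<in> {..k}"
    then have "of_nat (\<Sum>l\<le>m. (k choose l)\<^sup>2 * ((k - l) choose (m - l)))
      = (of_nat ((k choose m) * ((k + m) choose m)) :: 'a)"
      by (subst sum_choose_squared_mult_choose) auto
    then show "(\<Sum>l\<le>m. of_nat ((k choose l)\<^sup>2 * ((k - l) choose (m - l))) * (A ^ m * B ^ (k - m)))
      = of_nat ((k choose m) * ((k + m) choose m)) * A ^ m * B ^ (k - m)"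
      by (simp only: of_nat_sum mult.assoc flip: sum_distrib_right)
  qed simp
  finally show ?thesis by simp
qed

text \<open>The sum runs to \<open>k\<close>, padded by zero terms r > l, so that its range does not
  depend on \<open>l\<close> and summations can be exchanged.\<close>

lemma binomial_ring_complement:
  fixes z :: "'a::comm_ring_1"
  assumes "l \<le> k"
  shows "(1 + z) ^ l * z ^ (k - l) = (\<Sum>r\<le>k. of_nat (l choose r) * z ^ (k - r))"
proof -
  have "(1 + z) ^ l * z ^ (k - l) = (\<Sum>r\<le>l. of_nat (l choose r) * z ^ (k - r))"
    using assms by (auto simp: binomial_ring sum_distrib_right mult.assoc simp flip: power_add intro!: sum.cong)
  also have "\<dots> = (\<Sum>r\<le>k. of_nat (l choose r) * z ^ (k - r))"
    using assms by (intro sum.mono_neutral_left) (auto simp: binomial_eq_0)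
  finally show ?thesis .
qed

text \<open>With A = xy + y and B = x - y one has A = (1+x)y and A + B = (1+y)x. Each term of the
  rewritten sum is thus a polynomial in x times a polynomial in y, and expanding both gives the
  coefficients by \<open>sum_choose_squared_choose_choose\<close>.\<close>

lemma S_poly_eq_sum_conn_coeff:
  fixes x y :: "'a::comm_ring_1"
  shows "S_poly k x y = (\<Sum>i\<le>k. \<Sum>j\<le>k. of_nat (conn_coeff k i j) * (x ^ i * y ^ j))"
proof -
  have rev: "(\<Sum>r\<le>k. f (k - r)) = sum f {..k}" for f :: "nat \<Rightarrow> 'a"
    by (rule sum.reindex_bij_witness[of _ "\<lambda>r. k - r" "\<lambda>r. k - r"]) auto
  have "S_poly k x y
      = (\<Sum>l\<le>k. of_nat ((k choose l) * ((k + l) choose l)) * (x * y + y) ^ l * (x - y) ^ (k - l))"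
    unfolding S_poly_def atMost_atLeast0
  proof (rule sum.cong)
    fix l assume "l \<in> {0..k}"
    then have "((k + l) choose (2 * l)) * ((2 * l) choose l) = (k choose l) * ((k + l) choose l)"
      using choose_mult[of l "2 * l" "k + l"] by (simp add: mult.commute)
    then show "of_nat (((k + l) choose (2 * l)) * ((2 * l) choose l)) * (x * y + y) ^ l * (x - y) ^ (k - l)
      = of_nat ((k choose l) * ((k + l) choose l)) * (x * y + y) ^ l * (x - y) ^ (k - l)"
      by simp
  qed simp
  also have "\<dots> = (\<Sum>l\<le>k. of_nat ((k choose l)\<^sup>2) * (x * y + y) ^ l * (x * y + y + (x - y)) ^ (k - l))"
    by (rule sum_choose_choose_eq_sum_choose_squared)
  \<comment> \<open>The exponent \<open>l\<close> of y is written \<open>k - (k - l)\<close> to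
    match \<open>binomial_ring_complement\<close> with \<open>k - l\<close> in the role of
    \<open>l\<close>.\<close>
  also have "\<dots> = (\<Sum>l\<le>k. of_nat ((k choose l)\<^sup>2) *
      (((1 + x) ^ l * x ^ (k - l)) * ((1 + y) ^ (k - l) * y ^ (k - (k - l)))))"
  proof (rule sum.cong)
    fix l assume "l \<in> {..k}"
    then have l: "k - (k - l) = l" by simp
    have A: "x * y + y = (1 + x) * y" "x * y + y + (x - y) = (1 + y) * x"
      by (simp_all add: algebra_simps)
    show "of_nat ((k choose l)\<^sup>2) * (x * y + y) ^ l * (x * y + y + (x - y)) ^ (k - l)
      = of_nat ((k choose l)\<^sup>2) *
      (((1 + x) ^ l * x ^ (k - l)) * ((1 + y) ^ (k - l) * y ^ (k - (k - l))))"
      unfolding A(2) unfolding A(1) l power_mult_distrib by (simp only: mult_ac)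
  qed simp
  also have "\<dots> = (\<Sum>l\<le>k. \<Sum>r\<le>k. \<Sum>t\<le>k.
      of_nat ((k choose l)\<^sup>2 * (l choose r) * ((k - l) choose t)) * (x ^ (k - r) * y ^ (k - t)))"
  proof (rule sum.cong)
    fix l assume "l \<in> {..k}"
    then have l: "l \<le> k" "k - l \<le> k" by auto
    show "of_nat ((k choose l)\<^sup>2) * (((1 + x) ^ l * x ^ (k - l)) * ((1 + y) ^ (k - l) * y ^ (k - (k - l))))
      = (\<Sum>r\<le>k. \<Sum>t\<le>k.
      of_nat ((k choose l)\<^sup>2 * (l choose r) * ((k - l) choose t)) * (x ^ (k - r) * y ^ (k - t)))"
      unfolding binomial_ring_complement[OF l(1)] binomial_ring_complement[OF l(2)]
        sum_product
      unfolding sum_distrib_left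
      by (intro sum.cong) (simp_all add: mult_ac)
  qed simp
  also have "\<dots> = (\<Sum>r\<le>k. \<Sum>t\<le>k. \<Sum>l\<le>k.
      of_nat ((k choose l)\<^sup>2 * (l choose r) * ((k - l) choose t)) * (x ^ (k - r) * y ^ (k - t)))"
    by (subst sum.swap, rule sum.cong[OF refl], rule sum.swap)
  also have "\<dots> = (\<Sum>r\<le>k. \<Sum>t\<le>k. of_nat (conn_coeff k (k - r) (k - t)) * (x ^ (k - r) * y ^ (k - t)))"
  proof (intro sum.cong refl)
    fix r t assume "r \<in> {..k}" "t \<in> {..k}"
    then have "of_nat (\<Sum>l\<le>k. (k choose l)\<^sup>2 * (l choose r) * ((k - l) choose t))
        = (of_nat (conn_coeff k (k - r) (k - t)) :: 'a)"
      by (subst sum_choose_squared_choose_choose) auto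
    then show "(\<Sum>l\<le>k. of_nat ((k choose l)\<^sup>2 * (l choose r) * ((k - l) choose t)) * (x ^ (k - r) * y ^ (k - t)))
      = of_nat (conn_coeff k (k - r) (k - t)) * (x ^ (k - r) * y ^ (k - t))"
      by (simp only: of_nat_sum flip: sum_distrib_right)
  qed
  also have "\<dots> = (\<Sum>i\<le>k. \<Sum>j\<le>k. of_nat (conn_coeff k i j) * (x ^ i * y ^ j))"
    by (simp only: rev[of "\<lambda>j. of_nat (conn_coeff k i j) * (x ^ i * y ^ j)" for i]
        rev[of "\<lambda>i. \<Sum>j\<le>k. of_nat (conn_coeff k i j) * (x ^ i * y ^ j)"])
  finally show ?thesis .
qed

section \<open>Linearization of products\<close>

text \<open>Stated in a ring so that n - k is a genuine difference; for k > n both binomials are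
  0.\<close>

lemma Suc_times_choose_Suc:
  "of_nat (Suc k) * of_nat (n choose Suc k) = ((of_nat n - of_nat k) * of_nat (n choose k) :: 'a::comm_ring_1)"
proof (cases "k \<le> n")
  case True
  have "Suc k * (n choose Suc k) = (n - k) * (n choose k)"
    using binomial_absorb_comp[of n k] binomial_absorption[of k n] by (simp add: mult.commute)
  then show ?thesis
    using True by (metis of_nat_mult of_nat_diff)
qed (simp add: binomial_eq_0)

lemma Suc_times_choose_same:
  "of_nat (Suc k) * of_nat (k choose i) = ((of_nat (Suc k) - of_nat i) * of_nat (Suc k choose i) :: 'a::comm_ring_1)"
proof (cases "i \<le> Suc k")
  case True
  have "Suc k * (k choose i) = (Suc k - i) * (Suc k choose i)"
    using binomial_absorb_comp[of "Suc k" i] by simp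
  then show ?thesis
    using True by (metis of_nat_mult of_nat_diff)
qed (simp add: binomial_eq_0)

text \<open>This is the comparison of coefficients of w_(k+1) in the inductive step of
  \<open>product_linearization\<close>. All binomials with upper index \<open>k\<close> or
  \<open>Suc k\<close> are reduced to C(k+1, i) and C(k+1, j), leaving one linear relation between
  \<open>a\<close> and \<open>b\<close>.\<close>

lemma conn_coeff_rec:
  "of_nat (Suc i) ^ 2 * of_nat (conn_coeff (Suc k) (Suc i) j)
   = (of_nat (Suc k) ^ 2 * of_nat (conn_coeff k i j)
      + (of_nat (Suc k) - of_nat i) * (of_nat (Suc k) + of_nat (Suc i)) * of_nat (conn_coeff (Suc k) i j)
      :: 'a::comm_ring_1)"
proof -
  define a b c d :: 'a
    where "a = of_nat ((i + j) choose k)" and "b = of_nat ((i + j) choose Suc k)"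
      and "c = of_nat (Suc k choose i)" and "d = of_nat (Suc k choose j)"
  define c' ck dk :: 'a
    where "c' = of_nat (Suc k choose Suc i)" and "ck = of_nat (k choose i)" and "dk = of_nat (k choose j)"
  define I J K :: 'a where "I = of_nat i" and "J = of_nat j" and "K = of_nat (Suc k)"
  have c': "(I + 1) * c' = (K - I) * c"
    using Suc_times_choose_Suc[of i "Suc k", where 'a = 'a]
    by (simp add: c'_def c_def I_def K_def add.commute)
  have ck: "K * ck = (K - I) * c" and dk: "K * dk = (K - J) * d"
    using Suc_times_choose_same[of k i, where 'a = 'a] Suc_times_choose_same[of k j, where 'a = 'a]
    by (simp_all add: ck_def dk_def c_def d_def I_def J_def K_def del: of_nat_Suc)
  have b: "K * b = (I + J - K + 1) * a"
    using Suc_times_choose_Suc[of k "i + j", where 'a = 'a]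
    by (simp add: a_def b_def I_def J_def K_def add_diff_eq)
  \<comment> \<open>By Pascal's rule a + b is C(i+j+1, k+1).\<close>
  have "(I + 1)\<^sup>2 * ((a + b) * c' * d) = (I + 1) * ((I + 1) * c') * (a + b) * d"
    by (simp add: power2_eq_square algebra_simps)
  also have "\<dots> = (K - I) * c * d * ((I + 1) * a + (I + 1) * b)"
    unfolding c' by (simp add: algebra_simps)
  also have "(I + 1) * a + (I + 1) * b = (K - J) * a + (K + (I + 1)) * b"
    using b by (simp add: algebra_simps)
  also have "(K - I) * c * d * ((K - J) * a + (K + (I + 1)) * b)
      = a * ((K - I) * c) * ((K - J) * d) + (K - I) * (K + (I + 1)) * (b * c * d)"
    by (simp add: algebra_simps)
  also have "a * ((K - I) * c) * ((K - J) * d) = K\<^sup>2 * (a * ck * dk)"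
    unfolding ck[symmetric] dk[symmetric] by (simp add: power2_eq_square algebra_simps)
  finally show ?thesis
    by (simp add: conn_coeff_def a_def b_def c_def d_def c'_def ck_def dk_def I_def K_def add_ac)
qed

text \<open>Induction on \<open>i\<close>: the recurrence for w_(i+1) multiplies w_i w_j by u -
  i(i+1). In front of w_k this factor is split as (u - k(k+1)) + (k - i)(k + i + 1); the recurrence
  turns the first part into a multiple of w_(k+1), so \<open>u\<close> disappears.\<close>

lemma product_linearization:
  fixes w :: "nat \<Rightarrow> 'a::field_char_0"
  assumes w0: "w 0 = 1"
    and rec: "\<And>k. of_nat (Suc k) ^ 2 * w (Suc k) = (u - of_nat k * of_nat (Suc k)) * w k"
  shows "w i * w j = (\<Sum>k\<le>i + j. of_nat (conn_coeff k i j) * w k)"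
proof (induction i)
  case 0
  \<comment> \<open>C(j, k) C(k, j) vanishes unless k = j.\<close>
  have "(\<Sum>k\<le>j. of_nat (conn_coeff k 0 j) * w k) = (\<Sum>k\<in>{j}. of_nat (conn_coeff k 0 j) * w k)"
    by (intro sum.mono_neutral_right) (auto simp: conn_coeff_def)
  then show ?case
    by (simp add: w0 conn_coeff_def)
next
  case (Suc i)
  define d :: "nat \<Rightarrow> 'a" where "d k = of_nat (conn_coeff k i j)" for k
  \<comment> \<open>Boundary values for the index shift: the \<open>?g\<close> sum gains a zero term
    at the top and loses a zero term at k = 0.\<close>
  have d0: "of_nat i * d 0 = 0" and dN: "d (Suc (i + j)) = 0"
    by (auto simp: d_def conn_coeff_def)
  let ?g = "\<lambda>k. (of_nat k - of_nat i) * (of_nat k + of_nat (Suc i)) * d k * w k"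
  have "of_nat (Suc i) ^ 2 * (w (Suc i) * w j) = (u - of_nat i * of_nat (Suc i)) * (w i * w j)"
    using rec[of i] by (simp add: mult.assoc)
  also have "\<dots> = (\<Sum>k\<le>i + j. d k * ((u - of_nat i * of_nat (Suc i)) * w k))"
    unfolding Suc.IH sum_distrib_left d_def by (simp add: mult_ac)
  also have "\<dots> = (\<Sum>k\<le>i + j. of_nat (Suc k) ^ 2 * d k * w (Suc k) + ?g k)"
  proof (rule sum.cong)
    fix k
    have "(u - of_nat i * of_nat (Suc i)) * w k
      = of_nat (Suc k) ^ 2 * w (Suc k) + (of_nat k - of_nat i) * (of_nat k + of_nat (Suc i)) * w k"
      unfolding rec by (simp add: algebra_simps)
    then show "d k * ((u - of_nat i * of_nat (Suc i)) * w k) = of_nat (Suc k) ^ 2 * d k * w (Suc k) + ?g k"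
      by (simp add: algebra_simps)
  qed simp
  also have "\<dots> = (\<Sum>k\<le>i + j. of_nat (Suc k) ^ 2 * d k * w (Suc k)) + (\<Sum>k\<le>Suc (i + j). ?g k)"
    by (simp add: sum.distrib dN)
  also have "(\<Sum>k\<le>Suc (i + j). ?g k) = ?g 0 + (\<Sum>k\<le>i + j. ?g (Suc k))"
    by (rule sum.atMost_Suc_shift)
  also have "?g 0 = 0"
    using d0 by auto
  also have "(\<Sum>k\<le>i + j. of_nat (Suc k) ^ 2 * d k * w (Suc k)) + (0 + (\<Sum>k\<le>i + j. ?g (Suc k)))
      = (\<Sum>k\<le>i + j. (of_nat (Suc k) ^ 2 * d k
          + (of_nat (Suc k) - of_nat i) * (of_nat (Suc k) + of_nat (Suc i)) * d (Suc k)) * w (Suc k))"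
    unfolding add_0_left distrib_right sum.distrib ..
  also have "\<dots> = (\<Sum>k\<le>i + j. of_nat (Suc i) ^ 2 * (of_nat (conn_coeff (Suc k) (Suc i) j) * w (Suc k)))"
    unfolding d_def conn_coeff_rec[symmetric] by (simp only: mult.assoc)
  \<comment> \<open>The term k = 0 that the shift adds is 0, since C(0, i+1) = 0.\<close>
  also have "\<dots> = of_nat (Suc i) ^ 2 * (\<Sum>k\<le>Suc i + j. of_nat (conn_coeff k (Suc i) j) * w k)"
    unfolding add_Suc sum.atMost_Suc_shift by (simp add: conn_coeff_def sum_distrib_left)
  finally show ?case
    by (simp del: of_nat_Suc)
qed

section \<open>Divisibility and units in the p-adic integers\<close>

lemma to_fract_of_nat [simp]: "to_fract (of_nat n :: 'a::idom) = of_nat n"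
  by (induction n) simp_all

lemma to_fract_fact [simp]: "to_fract (fact n :: 'a::{idom, ring_char_0}) = fact n"
  by (metis of_nat_fact to_fract_of_nat)

lemma padic_residue_diff:
  "padic_residue (x - y :: 'p::prime_card padic_int) n
    = (padic_residue x n - padic_residue y n) mod int CARD('p) ^ n"
  by transfer simp

lemma padic_residue_range:
  "0 \<le> padic_residue (x :: 'p::prime_card padic_int) n" "padic_residue x n < int CARD('p) ^ n"
  by (transfer, auto)+

text \<open>Builds a p-adic integer from integers that are compatible only as residue
  classes.\<close>

lemma padic_residue_Abs_mod:
  assumes "\<And>n. g (Suc n) mod int CARD('p) ^ n = g n mod int CARD('p::prime_card) ^ n"
  shows "padic_residue (Abs_padic_int (\<lambda>n. g n mod int CARD('p) ^ n) :: 'p padic_int) n = g n mod int CARD('p) ^ n"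
  using padic_int_closed[of g, OF assms] by (subst Abs_padic_int_inverse) auto

lemma padic_int_eqI:
  "(\<And>n. padic_residue x n = padic_residue y n) \<Longrightarrow> x = (y :: 'p::prime_card padic_int)"
  by (metis padic_residue_inject ext)

lemma power_dvd_padic_int:
  fixes x :: "'p::prime_card padic_int"
  assumes "padic_residue x m = 0"
  shows "of_nat CARD('p) ^ m dvd x"
proof -
  let ?p = "int CARD('p)"
  \<comment> \<open>Dividing by p^m costs \<open>m\<close> digits, so the quotient modulo p^n is
    read off from \<open>x\<close> modulo p^(n+m).\<close>
  define g where "g n = padic_residue x (n + m) div ?p ^ m" for n
  have dvd: "?p ^ m dvd padic_residue x (n + m)" for n
    using padic_residue_add[of x m n] assms by (simp add: dvd_eq_mod_eq_0 add.commute)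
  have g: "?p ^ m * g n = padic_residue x (n + m)" for n
    using dvd by (simp add: g_def)
  have "g (Suc n) mod ?p ^ n = g n mod ?p ^ n" for n
  proof -
    have "(?p ^ m * g (Suc n)) mod (?p ^ m * ?p ^ n) = (?p ^ m * g n) mod (?p ^ m * ?p ^ n)"
      unfolding g using padic_residue_add[of x "n + m" 1] padic_residue_mod[of x "n + m"]
      by (simp add: power_add mult.commute)
    then show ?thesis
      by (simp only: mod_mult_mult1) simp
  qed
  note res = padic_residue_Abs_mod[of g, OF this]
  define y :: "'p padic_int" where "y = Abs_padic_int (\<lambda>n. g n mod ?p ^ n)"
  have "x = of_nat (CARD('p) ^ m) * y"
  proof (rule padic_int_eqI)
    fix n
    show "padic_residue x n = padic_residue (of_nat (CARD('p) ^ m) * y) n"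
      unfolding padic_residue_times y_def res padic_residue_of_nat mod_mult_eq
      using g[of n] padic_residue_add[of x n m] by simp
  qed
  then show ?thesis
    by simp
qed

text \<open>Inverses of \<open>u\<close> modulo the powers p^n exist; their uniqueness modulo p^n
  makes them compatible.\<close>

lemma of_nat_dvd_1_padic_int:
  assumes "coprime u CARD('p::prime_card)"
  shows "of_nat u dvd (1 :: 'p padic_int)"
proof -
  let ?p = "int CARD('p)"
  have cop: "coprime (int u) (?p ^ n)" for n
    using assms by simp
  then have "\<forall>n. \<exists>v. [int u * v = 1] (mod ?p ^ n)"
    using cong_solve_coprime_int by blast
  then obtain g where g: "\<And>n. [int u * g n = 1] (mod ?p ^ n)"
    by metis
  have "g (Suc n) mod ?p ^ n = g n mod ?p ^ n" for n
  proof -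
    have "[int u * g (Suc n) = 1] (mod ?p ^ n)"
      using g[of "Suc n"] by (rule cong_dvd_modulus) (simp add: le_imp_power_dvd)
    then have "[int u * g (Suc n) = int u * g n] (mod ?p ^ n)"
      using g[of n] cong_trans cong_sym by blast
    then have "[g (Suc n) = g n] (mod ?p ^ n)"
      by (simp only: cong_mult_lcancel[OF cop])
    then show ?thesis
      by (simp only: cong_def)
  qed
  note res = padic_residue_Abs_mod[of g, OF this]
  define y :: "'p padic_int" where "y = Abs_padic_int (\<lambda>n. g n mod ?p ^ n)"
  have "1 = of_nat u * y"
  proof (rule padic_int_eqI)
    fix n
    show "padic_residue (1 :: 'p padic_int) n = padic_residue (of_nat u * y) n"
      unfolding padic_residue_times y_def res padic_residue_of_nat padic_residue_1 mod_mult_eq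
      using g[of n] by (simp add: cong_def)
  qed
  then show ?thesis
    by (metis dvdI)
qed

text \<open>The ideal generated by \<open>N\<close> is closed: N is p^e times a unit, so
  approximating \<open>x\<close> by a multiple of \<open>N\<close> modulo p^e settles
  divisibility.\<close>

lemma of_nat_dvd_padic_intI:
  fixes x :: "'p::prime_card padic_int"
  assumes "N > 0" and "\<And>n. \<exists>z. of_nat CARD('p) ^ n dvd x - of_nat N * z"
  shows "of_nat N dvd x"
proof -
  obtain e u where N: "N = CARD('p) ^ e * u" and u: "\<not> CARD('p) dvd u"
    using multiplicity_decompose'[of N "CARD('p)"] assms(1) prime_card[where 'a = 'p] not_prime_unit
    by (metis gr_implies_not0)
  obtain z where "of_nat CARD('p) ^ e dvd x - of_nat N * z"
    using assms(2) by blast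
  moreover have "of_nat CARD('p) ^ e dvd of_nat N * z"
    by (simp add: N mult.assoc)
  ultimately have "of_nat CARD('p) ^ e dvd x"
    by (metis dvd_add diff_add_cancel)
  moreover have "coprime u CARD('p)"
    using u prime_card[where 'a = 'p] by (metis coprime_commute prime_imp_coprime)
  then have "of_nat u dvd (1 :: 'p padic_int)"
    by (rule of_nat_dvd_1_padic_int)
  ultimately have "of_nat CARD('p) ^ e * of_nat u dvd x * 1"
    by (rule mult_dvd_mono)
  then show ?thesis
    by (simp add: N)
qed

section \<open>Integrality of binomial coefficients of p-adic integers\<close>

lemma dvd_prod_diff:
  fixes f g :: "'i \<Rightarrow> 'a::comm_ring_1"
  assumes "\<And>i. i \<in> I \<Longrightarrow> d dvd f i - g i"
  shows "d dvd prod f I - prod g I"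
  using assms
proof (induction I rule: infinite_finite_induct)
  case (insert i I)
  have "prod f (insert i I) - prod g (insert i I)
      = (f i - g i) * prod f I + g i * (prod f I - prod g I)"
    using insert by (simp add: algebra_simps)
  moreover have "d dvd (f i - g i) * prod f I + g i * (prod f I - prod g I)"
    using insert by (intro dvd_add dvd_mult dvd_mult2) auto
  ultimately show ?case by simp
qed simp_all

text \<open>By density of the naturals: modulo p^n the falling factorial of \<open>x\<close> agrees
  with that of a natural number \<open>m\<close>, which is k! C(m, k). Hence it is a limit of
  multiples of k!, and so itself a multiple.\<close>

lemma gchoose_padic_int:
  fixes x :: "'p::prime_card padic_int"
  shows "to_fract x gchoose k \<in> \<int>\<^sub>p"
proof -
  have prod: "to_fract (\<Prod>i=0..<k. x - of_nat i) = fact k * (to_fract x gchoose k)" for x :: "'p padic_int"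
    unfolding gbinomial_mult_fact by (induction k) simp_all
  have "of_nat (fact k) dvd (\<Prod>i=0..<k. x - of_nat i)"
  proof (rule of_nat_dvd_padic_intI)
    fix n
    define m where "m = nat (padic_residue x n)"
    have "padic_residue (x - of_nat m) n = 0"
      unfolding padic_residue_diff padic_residue_of_nat m_def
      using padic_residue_range[of x n] by simp
    then have "of_nat CARD('p) ^ n dvd x - of_nat m"
      by (rule power_dvd_padic_int)
    then have "of_nat CARD('p) ^ n dvd (\<Prod>i=0..<k. x - of_nat i) - (\<Prod>i=0..<k. of_nat m - of_nat i)"
      by (intro dvd_prod_diff) simp
    \<comment> \<open>The identity is proved in the fraction field, where \<open>gchoose\<close>
      lives, and returns through injectivity of \<open>to_fract\<close>.\<close>
    moreover have "to_fract (\<Prod>i=0..<k. of_nat m - of_nat i :: 'p padic_int)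
        = to_fract (of_nat (fact k) * of_nat (m choose k))"
      unfolding prod by (simp add: binomial_gbinomial)
    then have "(\<Prod>i=0..<k. of_nat m - of_nat i :: 'p padic_int) = of_nat (fact k) * of_nat (m choose k)"
      by (simp only: to_fract_eq_iff)
    ultimately show "\<exists>z. of_nat CARD('p) ^ n dvd (\<Prod>i=0..<k. x - of_nat i) - of_nat (fact k) * z"
      by auto
  qed simp
  then obtain z where "(\<Prod>i=0..<k. x - of_nat i) = of_nat (fact k) * z"
    by (elim dvdE)
  then have "fact k * (to_fract x gchoose k) = fact k * to_fract z"
    by (metis prod to_fract_mult to_fract_of_nat of_nat_fact)
  then show ?thesis
    by (auto simp: padic_ints_def)
qed

section \<open>The coefficients \<open>w_coeff\<close>\<close>

lemma w_coeff_0 [simp]: "w_coeff 0 h = 1"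
  by (simp add: w_coeff_def)

lemma Suc_times_gchoose_Suc:
  fixes z :: "'a::field_char_0"
  shows "of_nat (Suc k) * (z gchoose Suc k) = (z - of_nat k) * (z gchoose k)"
  using gbinomial_mult_1[of z k] by (simp add: algebra_simps)

text \<open>The two binomials contribute h - k and h + k + 1, whose product depends on
  \<open>h\<close> only through h(h+1); this is the \<open>u\<close> of
  \<open>product_linearization\<close>.\<close>

lemma w_coeff_Suc:
  "of_nat (Suc k) ^ 2 * w_coeff (Suc k) h
    = (to_fract h * (to_fract h + 1) - of_nat k * of_nat (Suc k)) * w_coeff k h"
proof -
  let ?h = "to_fract h"
  have "of_nat (Suc k) * ((?h + of_nat (Suc k)) gchoose Suc k)
      = (?h + of_nat (Suc k)) * ((?h + of_nat k) gchoose k)"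
    using Suc_times_gbinomial[of k "?h + of_nat k"] by (simp add: add_ac)
  moreover have "of_nat (Suc k) ^ 2 * w_coeff (Suc k) h
      = (of_nat (Suc k) * (?h gchoose Suc k)) * (of_nat (Suc k) * ((?h + of_nat (Suc k)) gchoose Suc k))"
    by (simp add: w_coeff_def power2_eq_square mult_ac del: of_nat_Suc)
  ultimately have "of_nat (Suc k) ^ 2 * w_coeff (Suc k) h
      = ((?h - of_nat k) * (?h + of_nat (Suc k))) * w_coeff k h"
    unfolding Suc_times_gchoose_Suc by (simp add: w_coeff_def mult_ac)
  also have "(?h - of_nat k) * (?h + of_nat (Suc k)) = ?h * (?h + 1) - of_nat k * of_nat (Suc k)"
    by (simp add: algebra_simps)
  finally show ?thesis .
qed

text \<open>Used to recognize the quotients of factorials: as (k+1)^2 is nonzero, the recurrence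
  determines the sequence.\<close>

lemma w_coeff_eqI:
  assumes "c 0 = 1"
    and "\<And>k. of_nat (Suc k) ^ 2 * c (Suc k) = (to_fract h * (to_fract h + 1) - of_nat k * of_nat (Suc k)) * c k"
  shows "c k = w_coeff k h"
proof (induction k)
  case (Suc k)
  have "of_nat (Suc k) ^ 2 * c (Suc k) = of_nat (Suc k) ^ 2 * w_coeff (Suc k) h"
    unfolding assms(2) w_coeff_Suc Suc ..
  then show ?case
    by (simp del: of_nat_Suc)
qed (simp add: assms(1))

section \<open>Closure properties of the p-adic integers in their fraction field\<close>

lemma padic_ints_0 [simp]: "0 \<in> \<int>\<^sub>p"
  unfolding padic_ints_def by (metis rangeI to_fract_0)

lemma padic_ints_of_nat [simp]: "of_nat n \<in> \<int>\<^sub>p"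
  unfolding padic_ints_def by (metis rangeI to_fract_of_nat)

lemma padic_ints_add: "u \<in> \<int>\<^sub>p \<Longrightarrow> v \<in> \<int>\<^sub>p \<Longrightarrow> u + v \<in> \<int>\<^sub>p"
  by (auto simp: padic_ints_def simp flip: to_fract_add)

lemma padic_ints_mult: "u \<in> \<int>\<^sub>p \<Longrightarrow> v \<in> \<int>\<^sub>p \<Longrightarrow> u * v \<in> \<int>\<^sub>p"
  by (auto simp: padic_ints_def simp flip: to_fract_mult)

lemma padic_ints_sum: "(\<And>i. i \<in> I \<Longrightarrow> f i \<in> \<int>\<^sub>p) \<Longrightarrow> sum f I \<in> \<int>\<^sub>p"
  by (induction I rule: infinite_finite_induct) (auto intro: padic_ints_add)

lemma w_coeff_in_padic_ints: "w_coeff k h \<in> \<int>\<^sub>p"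
  unfolding w_coeff_def using gchoose_padic_int[of "h + of_nat k" k]
  by (intro padic_ints_mult gchoose_padic_int) simp

section \<open>The congruence\<close>

text \<open>y is the outer variable of R[x][y], hence the inner degree \<open>i\<close> and the
  outer degree \<open>j\<close>.\<close>

lemma const2_mult_indets:
  fixes c :: "'a::comm_ring_1"
  shows "const2 c * (indet_x ^ i * indet_y ^ j) = Polynomial.monom (Polynomial.monom c i) j"
proof -
  have "(indet_x :: 'a poly poly) ^ i = [:Polynomial.monom 1 i:]"
    by (simp add: poly_const_pow monom_altdef)
  moreover have "(indet_y :: 'a poly poly) ^ j = Polynomial.monom 1 j"
    by (simp add: monom_altdef)
  ultimately show ?thesis
    by (simp add: smult_monom)
qed

lemma coeff_coeff_sum_monomials:
  fixes f :: "nat \<Rightarrow> nat \<Rightarrow> 'a::comm_ring_1"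
  shows "poly.coeff (poly.coeff (\<Sum>i<q. \<Sum>j<q. const2 (f i j) * (indet_x ^ i * indet_y ^ j)) n) m
    = (if m < q \<and> n < q then f m n else 0)"
proof -
  have "poly.coeff (poly.coeff (\<Sum>i<q. \<Sum>j<q. const2 (f i j) * (indet_x ^ i * indet_y ^ j)) n) m
      = (\<Sum>i<q. \<Sum>j<q. if j = n then if i = m then f i j else 0 else 0)"
    unfolding const2_mult_indets by (auto simp: coeff_sum intro!: sum.cong)
  also have "\<dots> = (\<Sum>i<q. if i = m then if n < q then f i n else 0 else 0)"
    by (intro sum.cong) simp_all
  finally show ?thesis
    by simp
qed

lemma const2_sum: "const2 (sum f I) = (\<Sum>i\<in>I. const2 (f i))"
proof (induction I rule: infinite_finite_induct)
  case (insert i I)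
  have "const2 (f i + sum f I) = const2 (f i) + const2 (sum f I)"
    by simp
  with insert show ?case
    by (simp only: sum.insert not_False_eq_True)
qed simp_all

lemma w_coeff_product_diff:
  fixes h :: "'p::prime_card padic_int" and a :: nat
  defines "q \<equiv> CARD('p) ^ a"
  assumes ij: "i < q" "j < q"
  shows "\<exists>z\<in>\<int>\<^sub>p. w_coeff i h * w_coeff j h - (\<Sum>k<q. w_coeff k h * of_nat (conn_coeff k i j))
    = of_nat (CARD('p)\<^sup>2) * z"
proof -
  let ?p = "CARD('p)"
  \<comment> \<open>\<open>M\<close> exceeds \<open>q\<close> and \<open>i + j\<close>: the
    linearization is padded with zero terms up to \<open>M\<close> and then split at
    \<open>q\<close>.\<close>
  define M where "M = Suc (q + i + j)"
  have "w_coeff i h * w_coeff j h = (\<Sum>k\<le>i + j. of_nat (conn_coeff k i j) * w_coeff k h)"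
    by (rule product_linearization[OF w_coeff_0 w_coeff_Suc])
  also have "\<dots> = (\<Sum>k<M. w_coeff k h * of_nat (conn_coeff k i j))"
    unfolding mult.commute[of "w_coeff _ _"]
    by (rule sum.mono_neutral_left) (auto simp: conn_coeff_def M_def)
  also have "\<dots> = (\<Sum>k<q. w_coeff k h * of_nat (conn_coeff k i j))
      + (\<Sum>k=q..<M. w_coeff k h * of_nat (conn_coeff k i j))"
    unfolding lessThan_atLeast0 by (subst sum.atLeastLessThan_concat) (auto simp: M_def)
  also have "(\<Sum>k=q..<M. w_coeff k h * of_nat (conn_coeff k i j))
      = of_nat (?p\<^sup>2) * (\<Sum>k=q..<M. w_coeff k h * of_nat (conn_coeff k i j div ?p\<^sup>2))"
    unfolding sum_distrib_left
  proof (rule sum.cong)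
    fix k assume "k \<in> {q..<M}"
    then have "?p\<^sup>2 dvd conn_coeff k i j"
      using ij unfolding q_def by (intro prime_square_dvd_conn_coeff[OF prime_card]) auto
    then have "of_nat (conn_coeff k i j) = (of_nat (?p\<^sup>2) * of_nat (conn_coeff k i j div ?p\<^sup>2) :: 'p padic)"
      by (metis dvd_mult_div_cancel of_nat_mult)
    then show "w_coeff k h * of_nat (conn_coeff k i j)
      = of_nat (?p\<^sup>2) * (w_coeff k h * of_nat (conn_coeff k i j div ?p\<^sup>2))"
      by (simp only: mult_ac)
  qed simp
  finally show ?thesis
    by (intro bexI[of _ "\<Sum>k=q..<M. w_coeff k h * of_nat (conn_coeff k i j div ?p\<^sup>2)"])
      (auto intro!: padic_ints_sum padic_ints_mult w_coeff_in_padic_ints)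
qed

text \<open>Both sides are brought to sums of monomials x^i y^j with i, j < q, and
  \<open>w_coeff_product_diff\<close> compares the coefficients.\<close>

lemma w_coeff_product_cong:
  fixes h :: "'p::prime_card padic_int" and a :: nat
  defines "q \<equiv> CARD('p) ^ a"
  shows "[(\<Sum>k<q. const2 (w_coeff k h) * indet_x ^ k) * (\<Sum>k<q. const2 (w_coeff k h) * indet_y ^ k)
       \<equiv> (\<Sum>k<q. const2 (w_coeff k h) * S_poly k indet_x indet_y)] (mod\<^sub>p (CARD('p))\<^sup>2)"
proof -
  let ?x = "indet_x :: 'p padic poly poly" and ?y = "indet_y :: 'p padic poly poly"
  let ?w = "\<lambda>k. w_coeff k h"
  let ?g = "\<lambda>i j. \<Sum>k<q. ?w k * of_nat (conn_coeff k i j)"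
  have F: "(\<Sum>k<q. const2 (?w k) * ?x ^ k) * (\<Sum>k<q. const2 (?w k) * ?y ^ k)
      = (\<Sum>i<q. \<Sum>j<q. const2 (?w i * ?w j) * (?x ^ i * ?y ^ j))"
    unfolding sum_product
  proof (intro sum.cong refl)
    fix i j
    have "const2 (?w i * ?w j) = const2 (?w i) * const2 (?w j)"
      by simp
    then show "const2 (?w i) * ?x ^ i * (const2 (?w j) * ?y ^ j) = const2 (?w i * ?w j) * (?x ^ i * ?y ^ j)"
      by (simp only: mult_ac)
  qed
  have "const2 (?w k) * S_poly k ?x ?y
      = (\<Sum>i<q. \<Sum>j<q. const2 (?w k * of_nat (conn_coeff k i j)) * (?x ^ i * ?y ^ j))" if "k < q" for k
  proof -
    \<comment> \<open>For k < q the ranges i, j \<le> k extend to i, j < q, as C(k, i) or C(k, j)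
      vanishes on the new terms.\<close>
    have "S_poly k ?x ?y = (\<Sum>i<q. \<Sum>j<q. of_nat (conn_coeff k i j) * (?x ^ i * ?y ^ j))"
      unfolding S_poly_eq_sum_conn_coeff using that
      by (intro sum.mono_neutral_cong_left ballI sum.neutral) (auto simp: conn_coeff_def)
    moreover have "const2 (?w k * of_nat n) = const2 (?w k) * of_nat n" for n
      by (simp add: of_nat_poly)
    ultimately show ?thesis
      by (simp only: sum_distrib_left mult.assoc)
  qed
  then have "(\<Sum>k<q. const2 (?w k) * S_poly k ?x ?y)
      = (\<Sum>k<q. \<Sum>i<q. \<Sum>j<q. const2 (?w k * of_nat (conn_coeff k i j)) * (?x ^ i * ?y ^ j))"
    by (intro sum.cong) auto
  also have "\<dots> = (\<Sum>i<q. \<Sum>j<q. \<Sum>k<q. const2 (?w k * of_nat (conn_coeff k i j)) * (?x ^ i * ?y ^ j))"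
    by (subst sum.swap, rule sum.cong[OF refl], rule sum.swap)
  also have "\<dots> = (\<Sum>i<q. \<Sum>j<q. const2 (?g i j) * (?x ^ i * ?y ^ j))"
    by (simp only: const2_sum sum_distrib_right)
  finally have G: "(\<Sum>k<q. const2 (?w k) * S_poly k ?x ?y) = \<dots>" .
  have "?g i j \<in> \<int>\<^sub>p" "?w i * ?w j \<in> \<int>\<^sub>p" for i j
    by (auto intro!: padic_ints_sum padic_ints_mult w_coeff_in_padic_ints)
  moreover have "\<exists>z\<in>\<int>\<^sub>p. ?w i * ?w j - ?g i j = of_nat (CARD('p)\<^sup>2) * z" if "i < q" "j < q" for i j
    using w_coeff_product_diff[of i a j h] that by (simp add: q_def)
  \<comment> \<open>For degrees outside the square i, j < q, where both coefficients are 0.\<close>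
  moreover have "\<exists>z\<in>\<int>\<^sub>p. 0 - 0 = (of_nat (CARD('p)\<^sup>2) :: 'p padic) * z"
    by (rule bexI[of _ 0]) simp_all
  ultimately show ?thesis
    unfolding padic_poly_cong_def integral_poly2_def F G coeff_diff coeff_coeff_sum_monomials
    by (simp del: of_nat_power)
qed

section \<open>Four quotients of factorials\<close>

lemma padic_int_minus_inverse:
  assumes "coprime d CARD('p)"
  obtains h :: "'p::prime_card padic_int" where "of_nat d * to_fract h = -1"
proof -
  obtain v :: "'p padic_int" where "1 = of_nat d * v"
    using of_nat_dvd_1_padic_int[OF assms] by (elim dvdE)
  then have "of_nat d * to_fract v = 1"
    by (metis to_fract_1 to_fract_mult to_fract_of_nat)
  then show thesis
    by (intro that[of "- v"]) simp
qed

text \<open>For h = -1/d one has h(h+1) - k(k+1) = -(dk+1)(dk+d-1)/d^2. Multiplied by B = -b d^2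
  this is the factor in \<open>rec\<close>, so dividing \<open>rec\<close> by B^(k+1) gives the
  recurrence of \<open>w_coeff\<close>.\<close>

lemma quotient_product_cong:
  fixes t :: "nat \<Rightarrow> nat" and a b d e :: nat and B :: "'p::prime_card padic"
  defines "c \<equiv> \<lambda>k. of_nat (t k) / B ^ k" and "q \<equiv> CARD('p) ^ a"
  assumes d: "coprime d CARD('p)" "d = Suc e" and b: "b > 0" and B: "B = - of_nat (b * d\<^sup>2)"
    and t0: "t 0 = 1"
    and rec: "\<And>k. (Suc k)\<^sup>2 * t (Suc k) = b * (d * k + 1) * (d * k + e) * t k"
  shows "[(\<Sum>k<q. const2 (c k) * indet_x ^ k) * (\<Sum>k<q. const2 (c k) * indet_y ^ k)
       \<equiv> (\<Sum>k<q. const2 (c k) * S_poly k indet_x indet_y)] (mod\<^sub>p (CARD('p))\<^sup>2)"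
proof -
  obtain h :: "'p padic_int" where h: "of_nat d * to_fract h = -1"
    using padic_int_minus_inverse[OF d(1)] .
  define H where "H = to_fract h"
  have d0: "of_nat d \<noteq> (0 :: 'p padic)"
    by (simp add: d(2) del: of_nat_Suc)
  have H: "H = - 1 / of_nat d"
    using h d0 unfolding H_def by (metis nonzero_mult_div_cancel_left)
  have "B \<noteq> 0"
    using b d0 by (simp add: B)
  have "c k = w_coeff k h" for k
  proof (rule w_coeff_eqI)
    fix k
    have "of_nat e = (of_nat d - 1 :: 'p padic)"
      by (simp add: d(2))
    then have "of_nat (Suc k) ^ 2 * (of_nat (t (Suc k)) :: 'p padic)
      = of_nat b * (of_nat d * of_nat k + 1) * (of_nat d * of_nat k + (of_nat d - 1)) * of_nat (t k)"
      using arg_cong[OF rec[of k], where f = "of_nat :: nat \<Rightarrow> 'p padic"]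
      by (simp only: of_nat_mult of_nat_add of_nat_power of_nat_1)
    also have "of_nat b * (of_nat d * of_nat k + 1) * (of_nat d * of_nat k + (of_nat d - 1))
      = B * (H * (H + 1) - of_nat k * of_nat (Suc k))"
      unfolding B H using d0 by (simp add: field_simps power2_eq_square)
    finally show "of_nat (Suc k) ^ 2 * c (Suc k)
      = (to_fract h * (to_fract h + 1) - of_nat k * of_nat (Suc k)) * c k"
      using \<open>B \<noteq> 0\<close> by (simp add: c_def H_def)
  qed (simp add: c_def t0)
  then show ?thesis
    unfolding q_def by (simp only: w_coeff_product_cong)
qed

text \<open>For T = N/E and T' = nN/(eE) the ratio T'/T is n/e, which the third assumption reduces
  to r/s; everything is cross-multiplied to stay in the naturals.\<close>

lemma rec_of_quotient:
  fixes T T' E N e n r s :: nat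
  assumes "T * E = N" "T' * (e * E) = n * N" "e * r = n * s" "E > 0" "e > 0"
  shows "s * T' = r * T"
proof -
  have "(e * E) * (s * T') = s * (T' * (e * E))"
    by (simp add: mult_ac)
  also have "\<dots> = (n * s) * (T * E)"
    unfolding assms(1,2) by (simp add: mult_ac)
  also have "\<dots> = (e * E) * (r * T)"
    unfolding assms(3)[symmetric] by (simp add: mult_ac)
  finally show ?thesis
    using assms(4,5) by simp
qed

lemma choose_mult_fact_fact: "((m + n) choose m) * (fact m * fact n) = (fact (m + n) :: nat)"
  using binomial_fact_lemma[of m "m + n"] by (simp add: mult_ac)

lemma fact_numeral_mult_Suc:
  fixes k :: nat
  shows "(fact (2 * Suc k) :: nat) = (2 * k + 2) * (2 * k + 1) * fact (2 * k)"
    and "(fact (3 * Suc k) :: nat) = (3 * k + 3) * (3 * k + 2) * (3 * k + 1) * fact (3 * k)"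
    and "(fact (4 * Suc k) :: nat) = (4 * k + 4) * (4 * k + 3) * (4 * k + 2) * (4 * k + 1) * fact (4 * k)"
    and "(fact (6 * Suc k) :: nat)
      = (6 * k + 6) * (6 * k + 5) * (6 * k + 4) * (6 * k + 3) * (6 * k + 2) * (6 * k + 1) * fact (6 * k)"
  unfolding mult_Suc_right
  by (simp_all add: numeral_eq_Suc mult.assoc del: mult_Suc mult_Suc_right)

lemma fact_Suc_nat: "(fact (Suc k) :: nat) = (k + 1) * fact k"
  by simp

text \<open>The ratio of consecutive central binomials is 2(2k+1)/(k+1); it is then squared.\<close>

lemma choose_2k_squared_rec:
  "(Suc k)\<^sup>2 * (2 * Suc k choose Suc k)\<^sup>2 = 4 * (2 * k + 1) * (2 * k + 1) * (2 * k choose k)\<^sup>2"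
proof -
  have f: "(2 * m choose m) * (fact m * fact m) = (fact (2 * m) :: nat)" for m
    using choose_mult_fact_fact[of m m] by (simp add: mult_2)
  have "Suc k * (2 * Suc k choose Suc k) = 2 * (2 * k + 1) * (2 * k choose k)"
  proof (rule rec_of_quotient)
    show "(2 * Suc k choose Suc k) * ((Suc k * Suc k) * (fact k * fact k))
        = ((2 * k + 2) * (2 * k + 1)) * fact (2 * k)"
      using f[of "Suc k"] unfolding fact_Suc_nat fact_numeral_mult_Suc unfolding Suc_eq_plus1
      by (simp only: mult_ac)
    have e: "2 * k + 2 = 2 * (k + 1)"
      by simp_all
    show "(Suc k * Suc k) * (2 * (2 * k + 1)) = ((2 * k + 2) * (2 * k + 1)) * Suc k"
      unfolding Suc_eq_plus1 e power2_eq_square power3_eq_cube by (simp only: mult_ac)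
  qed (use f[of k] in \<open>simp_all only: fact_gt_zero mult_pos_pos zero_less_Suc\<close>)
  from arg_cong[OF this, where f = "\<lambda>n. n\<^sup>2"]
  have "(Suc k)\<^sup>2 * (2 * Suc k choose Suc k)\<^sup>2 = 2\<^sup>2 * (2 * k + 1)\<^sup>2 * (2 * k choose k)\<^sup>2"
    by (simp only: power_mult_distrib)
  moreover have "(2::nat)\<^sup>2 = 4"
    by simp
  ultimately show ?thesis
    by (simp only: power2_eq_square[of "2 * k + 1"] mult.assoc)
qed

text \<open>The product is (4k)! / ((2k)! k!^2).\<close>

lemma choose_4k_rec:
  "(Suc k)\<^sup>2 * ((4 * Suc k choose (2 * Suc k)) * (2 * Suc k choose Suc k))
    = 4 * (4 * k + 1) * (4 * k + 3) * ((4 * k choose (2 * k)) * (2 * k choose k))"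
proof (rule rec_of_quotient)
  have f: "((4 * m choose (2 * m)) * (2 * m choose m)) * (fact (2 * m) * (fact m * fact m)) = (fact (4 * m) :: nat)" for m
  proof -
    have "((4 * m choose (2 * m)) * (2 * m choose m)) * (fact (2 * m) * (fact m * fact m))
      = (4 * m choose (2 * m)) * (fact (2 * m) * ((2 * m choose m) * (fact m * fact m)))"
      by (simp only: mult_ac)
    also have "(2 * m choose m) * (fact m * fact m) = fact (2 * m)"
      using choose_mult_fact_fact[of m m] by (simp add: mult_2)
    also have "(4 * m choose (2 * m)) * (fact (2 * m) * fact (2 * m)) = fact (4 * m)"
      using choose_mult_fact_fact[of "2 * m" "2 * m"] by simp
    finally show ?thesis .
  qed
  show "((4 * k choose (2 * k)) * (2 * k choose k)) * (fact (2 * k) * (fact k * fact k)) = fact (4 * k)"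
    by (rule f)
  have "((2 * k + 2) * (2 * k + 1) * (Suc k)\<^sup>2) * (fact (2 * k) * (fact k * fact k))
      = (fact (2 * Suc k) * (fact (Suc k) * fact (Suc k)) :: nat)"
    unfolding fact_Suc_nat fact_numeral_mult_Suc power2_eq_square unfolding Suc_eq_plus1
    by (simp only: mult_ac)
  moreover have "fact (4 * Suc k) = ((4 * k + 4) * (4 * k + 3) * (4 * k + 2) * (4 * k + 1)) * (fact (4 * k) :: nat)"
    by (simp only: fact_numeral_mult_Suc)
  ultimately show "((4 * Suc k choose (2 * Suc k)) * (2 * Suc k choose Suc k)) *
      (((2 * k + 2) * (2 * k + 1) * (Suc k)\<^sup>2) * (fact (2 * k) * (fact k * fact k)))
      = ((4 * k + 4) * (4 * k + 3) * (4 * k + 2) * (4 * k + 1)) * fact (4 * k)"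
    using f[of "Suc k"] by (simp only:)
  have e: "2 * k + 2 = 2 * (k + 1)" "4 * k + 4 = 4 * (k + 1)" "4 * k + 2 = 2 * (2 * k + 1)"
    by simp_all
  show "((2 * k + 2) * (2 * k + 1) * (Suc k)\<^sup>2) * (4 * (4 * k + 1) * (4 * k + 3))
      = ((4 * k + 4) * (4 * k + 3) * (4 * k + 2) * (4 * k + 1)) * (Suc k)\<^sup>2"
    unfolding Suc_eq_plus1 e power2_eq_square power3_eq_cube by (simp only: mult_ac)
qed simp_all

text \<open>The product is (3k)! / k!^3.\<close>

lemma choose_3k_rec:
  "(Suc k)\<^sup>2 * ((2 * Suc k choose Suc k) * (3 * Suc k choose Suc k))
    = 3 * (3 * k + 1) * (3 * k + 2) * ((2 * k choose k) * (3 * k choose k))"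
proof (rule rec_of_quotient)
  have f: "((2 * m choose m) * (3 * m choose m)) * (fact m * (fact m * fact m)) = (fact (3 * m) :: nat)" for m
  proof -
    have "((2 * m choose m) * (3 * m choose m)) * (fact m * (fact m * fact m))
      = (3 * m choose m) * (fact m * ((2 * m choose m) * (fact m * fact m)))"
      by (simp only: mult_ac)
    also have "(2 * m choose m) * (fact m * fact m) = fact (2 * m)"
      using choose_mult_fact_fact[of m m] by (simp add: mult_2)
    also have "(3 * m choose m) * (fact m * fact (2 * m)) = fact (3 * m)"
      using choose_mult_fact_fact[of m "2 * m"] by simp
    finally show ?thesis .
  qed
  show "((2 * k choose k) * (3 * k choose k)) * (fact k * (fact k * fact k)) = fact (3 * k)"
    by (rule f)
  have "(Suc k)^3 * (fact k * (fact k * fact k))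
      = (fact (Suc k) * (fact (Suc k) * fact (Suc k)) :: nat)"
    unfolding fact_Suc_nat power3_eq_cube unfolding Suc_eq_plus1 by (simp only: mult_ac)
  moreover have "fact (3 * Suc k) = ((3 * k + 3) * (3 * k + 2) * (3 * k + 1)) * (fact (3 * k) :: nat)"
    by (simp only: fact_numeral_mult_Suc)
  ultimately show "((2 * Suc k choose Suc k) * (3 * Suc k choose Suc k)) *
      ((Suc k)^3 * (fact k * (fact k * fact k)))
      = ((3 * k + 3) * (3 * k + 2) * (3 * k + 1)) * fact (3 * k)"
    using f[of "Suc k"] by (simp only:)
  have e: "3 * k + 3 = 3 * (k + 1)"
    by simp_all
  show "(Suc k)^3 * (3 * (3 * k + 1) * (3 * k + 2))
      = ((3 * k + 3) * (3 * k + 2) * (3 * k + 1)) * (Suc k)\<^sup>2"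
    unfolding Suc_eq_plus1 e power2_eq_square power3_eq_cube by (simp only: mult_ac)
qed simp_all

text \<open>The product is (6k)! / ((3k)! k! (2k)!).\<close>

lemma choose_6k_rec:
  "(Suc k)\<^sup>2 * ((6 * Suc k choose (3 * Suc k)) * (3 * Suc k choose Suc k))
    = 12 * (6 * k + 1) * (6 * k + 5) * ((6 * k choose (3 * k)) * (3 * k choose k))"
proof (rule rec_of_quotient)
  have f: "((6 * m choose (3 * m)) * (3 * m choose m)) * (fact (3 * m) * (fact m * fact (2 * m))) = (fact (6 * m) :: nat)" for m
  proof -
    have "((6 * m choose (3 * m)) * (3 * m choose m)) * (fact (3 * m) * (fact m * fact (2 * m)))
      = (6 * m choose (3 * m)) * (fact (3 * m) * ((3 * m choose m) * (fact m * fact (2 * m))))"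
      by (simp only: mult_ac)
    also have "(3 * m choose m) * (fact m * fact (2 * m)) = fact (3 * m)"
      using choose_mult_fact_fact[of m "2 * m"] by simp
    also have "(6 * m choose (3 * m)) * (fact (3 * m) * fact (3 * m)) = fact (6 * m)"
      using choose_mult_fact_fact[of "3 * m" "3 * m"] by simp
    finally show ?thesis .
  qed
  show "((6 * k choose (3 * k)) * (3 * k choose k)) * (fact (3 * k) * (fact k * fact (2 * k))) = fact (6 * k)"
    by (rule f)
  have "((3 * k + 3) * (3 * k + 2) * (3 * k + 1) * Suc k * ((2 * k + 2) * (2 * k + 1))) * (fact (3 * k) * (fact k * fact (2 * k)))
      = (((3 * k + 3) * (3 * k + 2) * (3 * k + 1)) * fact (3 * k)) * (fact (Suc k) * fact (2 * Suc k) :: nat)"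
    unfolding fact_Suc_nat fact_numeral_mult_Suc(1) unfolding Suc_eq_plus1 by (simp only: mult_ac)
  moreover have "fact (3 * Suc k) = ((3 * k + 3) * (3 * k + 2) * (3 * k + 1)) * (fact (3 * k) :: nat)"
    by (simp only: fact_numeral_mult_Suc)
  moreover have "fact (6 * Suc k)
      = ((6 * k + 6) * (6 * k + 5) * (6 * k + 4) * (6 * k + 3) * (6 * k + 2) * (6 * k + 1)) * (fact (6 * k) :: nat)"
    by (simp only: fact_numeral_mult_Suc)
  ultimately show "((6 * Suc k choose (3 * Suc k)) * (3 * Suc k choose Suc k)) *
      (((3 * k + 3) * (3 * k + 2) * (3 * k + 1) * Suc k * ((2 * k + 2) * (2 * k + 1))) * (fact (3 * k) * (fact k * fact (2 * k))))
      = ((6 * k + 6) * (6 * k + 5) * (6 * k + 4) * (6 * k + 3) * (6 * k + 2) * (6 * k + 1)) * fact (6 * k)"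
    using f[of "Suc k"] by (simp only:)
  \<comment> \<open>Common factors, and the numeral 12, are split until the two sides differ only by
    the order of their factors.\<close>
  have e: "2 * k + 2 = 2 * (k + 1)" "3 * k + 3 = 3 * (k + 1)" "6 * k + 6 = 6 * (k + 1)" "6 * k + 4 = 2 * (3 * k + 2)" "6 * k + 3 = 3 * (2 * k + 1)" "6 * k + 2 = 2 * (3 * k + 1)" "12 = 6 * (2 :: nat)"
    by simp_all
  show "((3 * k + 3) * (3 * k + 2) * (3 * k + 1) * Suc k * ((2 * k + 2) * (2 * k + 1))) * (12 * (6 * k + 1) * (6 * k + 5))
      = ((6 * k + 6) * (6 * k + 5) * (6 * k + 4) * (6 * k + 3) * (6 * k + 2) * (6 * k + 1)) * (Suc k)\<^sup>2"
    unfolding Suc_eq_plus1 e power2_eq_square power3_eq_cube by (simp only: mult_ac)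
qed simp_all

section \<open>The general congruence and its four special cases\<close>

theorem theorem3p2:
  fixes p a :: nat and h :: "'p::prime_card padic_int"
    and x y :: "'p padic poly poly"
  assumes p: "p = CARD('p)" and a: "a > 0"
    and x: "x = indet_x" and y: "y = indet_y"
  shows
    "[(\<Sum>k<p^a. const2 (w_coeff k h) * x ^ k) * (\<Sum>k<p^a. const2 (w_coeff k h) * y ^ k)
       \<equiv> (\<Sum>k<p^a. const2 (w_coeff k h) * S_poly k x y)] (mod\<^sub>p p\<^sup>2)
     \<and> (p \<noteq> 2 \<longrightarrow>
         (let c = (\<lambda>k. of_nat ((2*k choose k)\<^sup>2) / (-16) ^ k :: 'p padic)
          in [(\<Sum>k<p^a. const2 (c k) * x ^ k) * (\<Sum>k<p^a. const2 (c k) * y ^ k)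
               \<equiv> (\<Sum>k<p^a. const2 (c k) * S_poly k x y)] (mod\<^sub>p p\<^sup>2))
       \<and> (let c = (\<lambda>k. of_nat ((4*k choose (2*k)) * (2*k choose k)) / (-64) ^ k :: 'p padic)
          in [(\<Sum>k<p^a. const2 (c k) * x ^ k) * (\<Sum>k<p^a. const2 (c k) * y ^ k)
               \<equiv> (\<Sum>k<p^a. const2 (c k) * S_poly k x y)] (mod\<^sub>p p\<^sup>2)))
     \<and> (p > 3 \<longrightarrow>
         (let c = (\<lambda>k. of_nat ((2*k choose k) * (3*k choose k)) / (-27) ^ k :: 'p padic)
          in [(\<Sum>k<p^a. const2 (c k) * x ^ k) * (\<Sum>k<p^a. const2 (c k) * y ^ k)
               \<equiv> (\<Sum>k<p^a. const2 (c k) * S_poly k x y)] (mod\<^sub>p p\<^sup>2))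
       \<and> (let c = (\<lambda>k. of_nat ((6*k choose (3*k)) * (3*k choose k)) / (-432) ^ k :: 'p padic)
          in [(\<Sum>k<p^a. const2 (c k) * x ^ k) * (\<Sum>k<p^a. const2 (c k) * y ^ k)
               \<equiv> (\<Sum>k<p^a. const2 (c k) * S_poly k x y)] (mod\<^sub>p p\<^sup>2)))"
proof -
  have prime: "prime p"
    using p prime_card by simp
  have cop: "coprime d CARD('p)" if "\<not> p dvd d" for d
    using that prime p by (metis coprime_commute prime_imp_coprime)
  have cop24: "coprime 2 CARD('p)" "coprime 4 CARD('p)" if "p \<noteq> 2"
  proof -
    show "coprime 2 CARD('p)"
      using that prime by (intro cop) (auto simp: primes_dvd_imp_eq)
    then show "coprime 4 CARD('p)"
      using coprime_power_left_iff[of 2 2 "CARD('p)"] by simp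
  qed
  have cop36: "coprime 3 CARD('p)" "coprime 6 CARD('p)" if "p > 3"
  proof -
    show "coprime 3 CARD('p)"
      using that by (intro cop) (auto dest: dvd_imp_le)
    then show "coprime 6 CARD('p)"
      using coprime_mult_left_iff[of 2 3 "CARD('p)"] cop24(1) that by simp
  qed
  show ?thesis
    unfolding x y Let_def p
  proof (intro conjI impI)
    show "[(\<Sum>k<CARD('p) ^ a. const2 (w_coeff k h) * indet_x ^ k)
          * (\<Sum>k<CARD('p) ^ a. const2 (w_coeff k h) * indet_y ^ k)
        \<equiv> (\<Sum>k<CARD('p) ^ a. const2 (w_coeff k h) * S_poly k indet_x indet_y)] (mod\<^sub>p (CARD('p))\<^sup>2)"
      by (rule w_coeff_product_cong)
    show "[(\<Sum>k<CARD('p) ^ a. const2 (of_nat ((2 * k choose k)\<^sup>2) / (- 16) ^ k) * indet_x ^ k)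
          * (\<Sum>k<CARD('p) ^ a. const2 (of_nat ((2 * k choose k)\<^sup>2) / (- 16) ^ k) * indet_y ^ k)
        \<equiv> (\<Sum>k<CARD('p) ^ a. const2 (of_nat ((2 * k choose k)\<^sup>2) / (- 16) ^ k :: 'p padic)
              * S_poly k indet_x indet_y)] (mod\<^sub>p (CARD('p))\<^sup>2)"
      if "CARD('p) \<noteq> 2"
      \<comment> \<open>h = -1/2, and -16 = -(4 * 2^2).\<close>
      by (rule quotient_product_cong[where t = "\<lambda>k. (2 * k choose k)\<^sup>2" and d = 2 and e = 1 and b = 4, OF _ _ _ _ _ choose_2k_squared_rec])
        (use cop24 that p in simp_all)
    show "[(\<Sum>k<CARD('p) ^ a. const2 (of_nat ((4 * k choose (2 * k)) * (2 * k choose k)) / (- 64) ^ k) * indet_x ^ k)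
          * (\<Sum>k<CARD('p) ^ a. const2 (of_nat ((4 * k choose (2 * k)) * (2 * k choose k)) / (- 64) ^ k) * indet_y ^ k)
        \<equiv> (\<Sum>k<CARD('p) ^ a. const2 (of_nat ((4 * k choose (2 * k)) * (2 * k choose k)) / (- 64) ^ k :: 'p padic)
              * S_poly k indet_x indet_y)] (mod\<^sub>p (CARD('p))\<^sup>2)"
      if "CARD('p) \<noteq> 2"
      \<comment> \<open>h = -1/4, and -64 = -(4 * 4^2).\<close>
      by (rule quotient_product_cong[where t = "\<lambda>k. (4 * k choose (2 * k)) * (2 * k choose k)" and d = 4 and e = 3 and b = 4, OF _ _ _ _ _ choose_4k_rec])
        (use cop24 that p in simp_all)
    show "[(\<Sum>k<CARD('p) ^ a. const2 (of_nat ((2 * k choose k) * (3 * k choose k)) / (- 27) ^ k) * indet_x ^ k)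
          * (\<Sum>k<CARD('p) ^ a. const2 (of_nat ((2 * k choose k) * (3 * k choose k)) / (- 27) ^ k) * indet_y ^ k)
        \<equiv> (\<Sum>k<CARD('p) ^ a. const2 (of_nat ((2 * k choose k) * (3 * k choose k)) / (- 27) ^ k :: 'p padic)
              * S_poly k indet_x indet_y)] (mod\<^sub>p (CARD('p))\<^sup>2)"
      if "3 < CARD('p)"
      \<comment> \<open>h = -1/3, and -27 = -(3 * 3^2).\<close>
      by (rule quotient_product_cong[where t = "\<lambda>k. (2 * k choose k) * (3 * k choose k)" and d = 3 and e = 2 and b = 3, OF _ _ _ _ _ choose_3k_rec])
        (use cop36 that p in simp_all)
    show "[(\<Sum>k<CARD('p) ^ a. const2 (of_nat ((6 * k choose (3 * k)) * (3 * k choose k)) / (- 432) ^ k) * indet_x ^ k)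
          * (\<Sum>k<CARD('p) ^ a. const2 (of_nat ((6 * k choose (3 * k)) * (3 * k choose k)) / (- 432) ^ k) * indet_y ^ k)
        \<equiv> (\<Sum>k<CARD('p) ^ a. const2 (of_nat ((6 * k choose (3 * k)) * (3 * k choose k)) / (- 432) ^ k :: 'p padic)
              * S_poly k indet_x indet_y)] (mod\<^sub>p (CARD('p))\<^sup>2)"
      if "3 < CARD('p)"
      \<comment> \<open>h = -1/6, and -432 = -(12 * 6^2).\<close>
      by (rule quotient_product_cong[where t = "\<lambda>k. (6 * k choose (3 * k)) * (3 * k choose k)" and d = 6 and e = 5 and b = 12, OF _ _ _ _ _ choose_6k_rec])
        (use cop36 that p in simp_all)
  qed
qed

end
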